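(* Fix an integer $d>1$, and let $\mathcal{P}_d$ be the property of being a polynomial of degree at most $d$ over $\mathbb{F}_2$. There exists $n_0=n_0(d)$ such that for all $n\ge n_0$, all $\varepsilon\in(0,1/3]$, and all $t\in\mathbb{N}$, every $\varepsilon$-tester for $\mathcal{P}_d$ of functions $f:\{0,1\}^n\to\{0,1\}$ that works in the presence of a $t$-online fixed-rate erasure adversary must make $\Omega(\log^d t)$ queries, where the constant in the $\Omega(\cdot)$ depends only on $d$.
   Context: $\log$ is base 2. $\mathcal{P}_d$ is the set of functions $\{0,1\}^n\to\{0,1\}$ that can be written as a sum mod 2 of monomials $\prod_{i\in S}x[i]$ with $S\subseteq[n]$, $|S|\le d$ ($S=\emptyset$ allowed). Online model. The input is a function $f$ on a finite domain. Access is via a sequence of oracles $\mathcal{O}_1,\mathcal{O}_2,\dots$, where $\mathcal{O}_i$ answers the $i$-th query and $\mathcal{O}_1=f$. After each query the adversary chooses the next oracle; its strategy may depend on the input, the tester's description, and all queries made so far, but not on the tester's future coin tosses. Let $\mathrm{Dist}$ denote Hamming distance (number of points with different answers). A $t$-online fixed-rate adversary must satisfy $\mathrm{Dist}(\mathcal{O}_i,\mathcal{O}_{i+1})\le\lfloor(i+1)t\rfloor-\lfloor it\rfloor$ for all $i\in\mathbb{N}$ (so for integer $t$, at most $t$ changes after each query). An erasure adversary must satisfy $\mathcal{O}_{i+1}(x)\in\{\mathcal{O}_i(x),\perp\}$ for all $x$ ($\perp$ is the erasure symbol). $f$ is $\varepsilon$-far from a property $\mathcal{P}$ if at least an $\varepsilon$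 fraction of the values of $f$ must be changed to obtain a function in $\mathcal{P}$. An (online) $\varepsilon$-tester for $\mathcal{P}$ working in the presence of a given type of adversary is a randomized (possibly adaptive) algorithm that, for every adversarial strategy of that type, accepts with probability at least $2/3$ if $f\in\mathcal{P}$ and rejects with probability at least $2/3$ if $f$ is $\varepsilon$-far from $\mathcal{P}$. *)

theory Defs
  imports "HOL-Probability.Probability" "HOL-Library.Z2"
begin

text \<open>
  Input functions are total HOL functions on the point type; only their values on the finite
  domain \<open>D\<close> matter.  The answer \<^term>\<open>None\<close> of a query-answering function is the erasure symbol.
\<close>

type_synonym ('x, 'v) query_oracle = "'x \<Rightarrow> 'v option"

definition oracle_dist :: "'x set \<Rightarrow> ('x, 'v) query_oracle \<Rightarrow> ('x, 'v) query_oracle \<Rightarrow> nat" where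
  "oracle_dist D P Q = card {x \<in> D. P x \<noteq> Q x}"

text \<open>
  A strategy maps the list of the first \<open>i\<close> queries (in order) to the function that answers
  query \<open>i + 1\<close>.  The dependence on the input and on the tester is expressed by quantifying
  over strategies after these have been fixed; the coins of the tester are drawn afterwards.
\<close>

type_synonym ('x, 'v) strategy = "'x list \<Rightarrow> ('x, 'v) query_oracle"

definition starts_with :: "'x set \<Rightarrow> ('x \<Rightarrow> 'v) \<Rightarrow> ('x, 'v) strategy \<Rightarrow> bool" where
  "starts_with D f A \<longleftrightarrow> (\<forall>y\<in>D. A [] y = Some (f y))"

text \<open>
  With \<open>i = length qs + 1\<close>, the function \<open>A qs\<close> answers the \<open>i\<close>-th query \<open>x\<close>,
  and \<open>A (qs @ [x])\<close> is its successor.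
\<close>

definition fixed_rate :: "'x set \<Rightarrow> real \<Rightarrow> ('x, 'v) strategy \<Rightarrow> bool" where
  "fixed_rate D t A \<longleftrightarrow>
     (\<forall>qs x. set qs \<subseteq> D \<longrightarrow> x \<in> D \<longrightarrow>
        (let i = length qs + 1 in
           int (oracle_dist D (A qs) (A (qs @ [x]))) \<le> \<lfloor>real (i + 1) * t\<rfloor> - \<lfloor>real i * t\<rfloor>))"

definition erasing :: "'x set \<Rightarrow> ('x, 'v) strategy \<Rightarrow> bool" where
  "erasing D A \<longleftrightarrow>
     (\<forall>qs x. set qs \<subseteq> D \<longrightarrow> x \<in> D \<longrightarrow> (\<forall>y\<in>D. A (qs @ [x]) y \<in> {A qs y, None}))"

definition fixed_rate_erasure_adversary ::
    "'x set \<Rightarrow> real \<Rightarrow> ('x \<Rightarrow> 'v) \<Rightarrow> ('x, 'v) strategy set" where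
  "fixed_rate_erasure_adversary D t f =
     {A. starts_with D f A \<and> fixed_rate D t A \<and> erasing D A}"

text \<open>
  Deterministic adaptive algorithms are decision trees, \<open>Halt True\<close> meaning acceptance.
  A randomized algorithm is a distribution over them; on a finite domain with finitely many
  values there are only countably many such trees, so a pmf is no restriction.
\<close>

datatype ('x, 'v) algorithm =
    Halt bool
  | Query 'x "'v option \<Rightarrow> ('x, 'v) algorithm"

primrec queries_in :: "'x set \<Rightarrow> ('x, 'v) algorithm \<Rightarrow> bool" where
  "queries_in D (Halt b) \<longleftrightarrow> True"
| "queries_in D (Query x k) \<longleftrightarrow> x \<in> D \<and> (\<forall>r. queries_in D (k r))"

text \<open>
  The last argument of \<open>run\<close> lists the queries made so far; the result consists of all
  queries made (repetitions included) and the verdict.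
\<close>

primrec run ::
    "('x, 'v) strategy \<Rightarrow> ('x, 'v) algorithm \<Rightarrow> 'x list \<Rightarrow> 'x list \<times> bool" where
  "run A (Halt b) qs = (qs, b)"
| "run A (Query x k) qs = run A (k (A qs x)) (qs @ [x])"

definition accepts :: "('x, 'v) strategy \<Rightarrow> ('x, 'v) algorithm \<Rightarrow> bool" where
  "accepts A a \<longleftrightarrow> snd (run A a [])"

definition num_queries :: "('x, 'v) strategy \<Rightarrow> ('x, 'v) algorithm \<Rightarrow> nat" where
  "num_queries A a = length (fst (run A a []))"

definition far_from :: "'x set \<Rightarrow> real \<Rightarrow> ('x \<Rightarrow> 'v) set \<Rightarrow> ('x \<Rightarrow> 'v) \<Rightarrow> bool" where
  "far_from D \<epsilon> P f \<longleftrightarrow> (\<forall>g\<in>P. real (card {x \<in> D. f x \<noteq> g x}) \<ge> \<epsilon> * real (card D))"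

definition online_tester ::
    "'x set \<Rightarrow> ('x \<Rightarrow> 'v) set \<Rightarrow> real \<Rightarrow> (('x \<Rightarrow> 'v) \<Rightarrow> ('x, 'v) strategy set)
      \<Rightarrow> ('x, 'v) algorithm pmf \<Rightarrow> bool" where
  "online_tester D P \<epsilon> Adv T \<longleftrightarrow>
     (\<forall>a\<in>set_pmf T. queries_in D a) \<and>
     (\<forall>f. \<forall>A\<in>Adv f.
        (f \<in> P \<longrightarrow> measure_pmf.prob T {a. accepts A a} \<ge> 2 / 3) \<and>
        (far_from D \<epsilon> P f \<longrightarrow> measure_pmf.prob T {a. \<not> accepts A a} \<ge> 2 / 3))"

text \<open>Worst-case query complexity: over all inputs, strategies and coin tosses.\<close>

definition makes_at_most ::
    "(('x \<Rightarrow> 'v) \<Rightarrow> ('x, 'v) strategy set) \<Rightarrow> ('x, 'v) algorithm pmf \<Rightarrow> nat \<Rightarrow> bool" where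
  "makes_at_most Adv T q \<longleftrightarrow> (\<forall>f. \<forall>A\<in>Adv f. \<forall>a\<in>set_pmf T. num_queries A a \<le> q)"

definition cube :: "nat \<Rightarrow> bit list set" where
  "cube n = {x. length x = n}"

text \<open>Arithmetic in type \<^typ>\<open>bit\<close> is modulo 2; coordinates are numbered from 0.\<close>

definition polys :: "nat \<Rightarrow> nat \<Rightarrow> (bit list \<Rightarrow> bit) set" where
  "polys n d =
     {f. \<exists>M \<subseteq> {S. S \<subseteq> {..<n} \<and> card S \<le> d}. \<forall>x\<in>cube n. f x = (\<Sum>S\<in>M. \<Prod>i\<in>S. x ! i)}"

end

theory Submission
  imports Defs "HOL-Real_Asymp.Real_Asymp" "HOL-Library.Sublist"
begin

text \<open>
  The adversary erases, after each query, all points whose value under polynomials of degree at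
  most \<open>d\<close> is determined by the values at the queried points.  As long as it can keep up, every
  unerased answer splits both the set of all polynomials and the set of all functions into halves,
  so the tester sees uniform bits in either case; yet a uniformly random function is \<open>1/3\<close>-far from
  all polynomials, by a Chernoff bound and a union bound over the polynomials.

  The adversary keeps up because a set \<open>Y\<close> of at least \<open>2 ^ k\<close> points is not determined by fewer
  than \<open>\<Sum>i\<le>d. k choose i\<close> of its values.  Splitting \<open>Y\<close> by the first coordinate into \<open>Y0\<close> and \<open>Y1\<close>
  and writing polynomials as \<open>g + x[0] * h\<close>, the dimension of the degree-\<open>d\<close> functions on \<open>Y\<close> is
  at least the one for degree \<open>d\<close> on \<open>Y0 \<union> Y1\<close> plus the one for degree \<open>d - 1\<close> on \<open>Y0 \<inter> Y1\<close>.
  The number of \<open>i < card Y\<close> with at most \<open>d\<close> binary digits \<open>1\<close> satisfies the reverse inequality.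
\<close>

section \<open>Integers of bounded binary weight\<close>

fun bit_weight :: "nat \<Rightarrow> nat" where
  "bit_weight n = (if n = 0 then 0 else n mod 2 + bit_weight (n div 2))"

declare bit_weight.simps [simp del]

lemma bit_weight_0 [simp]: "bit_weight 0 = 0"
  by (simp add: bit_weight.simps)

lemma bit_weight_double [simp]: "bit_weight (2 * n) = bit_weight n"
  by (cases "n = 0") (auto simp: bit_weight.simps[of "2 * n"])

lemma bit_weight_Suc_double [simp]: "bit_weight (Suc (2 * n)) = Suc (bit_weight n)"
  by (auto simp: bit_weight.simps[of "Suc (2 * n)"])

text \<open>At \<open>s = 2 ^ k\<close> this is the sum of \<open>k choose i\<close> over
  \<open>i < e\<close>, the dimension of the polynomials of degree below \<open>e\<close> in
  \<open>k\<close> variables. The strict bound makes \<open>e - 1\<close> harmless at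
  \<open>e = 0\<close>, where both counts vanish.\<close>

primrec light_count :: "nat \<Rightarrow> nat \<Rightarrow> nat" where
  "light_count e 0 = 0"
| "light_count e (Suc s) = light_count e s + (if bit_weight s < e then 1 else 0)"

lemma light_count_0 [simp]: "light_count 0 s = 0"
  by (induction s) auto

lemma light_count_mono: "s \<le> s' \<Longrightarrow> light_count e s \<le> light_count e s'"
  by (rule lift_Suc_mono_le) auto

text \<open>The numbers below \<open>2 * s\<close> are \<open>2 * i\<close> and
  \<open>2 * i + 1\<close> with \<open>i < s\<close>; the last digit of the odd ones uses up one
  unit of weight.\<close>

lemma light_count_double: "light_count e (2 * s) = light_count e s + light_count (e - 1) s"
  by (induction s) auto

lemma light_count_Suc_double:
  "light_count e (Suc (2 * s)) = light_count e (Suc s) + light_count (e - 1) s"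
  using light_count_double[of e s] by simp

text \<open>Strong induction on \<open>a + b\<close>: counting even and odd numbers separately
  reduces the claim to the same inequality for about half the size, once with \<open>e\<close> and
  once with \<open>e - 1\<close>.\<close>

lemma light_count_add:
  "b \<le> a \<Longrightarrow> light_count e (a + b) \<le> light_count e a + light_count (e - 1) b"
proof (induction "a + b" arbitrary: a b e rule: less_induct)
  case less
  note IH = less.hyps
  \<comment> \<open>For \<open>b = 0\<close> halving need not decrease the sum
    (\<open>a = 1\<close>). For odd \<open>a = b\<close> the induction hypothesis would need
    \<open>Suc b' \<le> a'\<close>, which fails; there the doubling identity gives equality.\<close>
  consider "b = 0" | "a = b" | "0 < b" "b < a" using less.prems by linarith
  then show ?case
  proof cases
    case 1 then show ?thesis by simp
  next
    case 2 then show ?thesis using light_count_double[of e b] by (simp add: mult_2)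
  next
    case 3
    obtain a' where a: "a = 2 * a' \<or> a = Suc (2 * a')" by (metis evenE oddE Suc_eq_plus1)
    obtain b' where b: "b = 2 * b' \<or> b = Suc (2 * b')" by (metis evenE oddE Suc_eq_plus1)
    consider (ee) "a = 2 * a'" "b = 2 * b'" | (oe) "a = Suc (2 * a')" "b = 2 * b'"
      | (eo) "a = 2 * a'" "b = Suc (2 * b')" | (oo) "a = Suc (2 * a')" "b = Suc (2 * b')"
      using a b by blast
    then show ?thesis
    proof cases
      case ee
      have eq: "a + b = 2 * (a' + b')" using ee by simp
      show ?thesis
        using IH[of a' b' e] IH[of a' b' "e - 1"] 3 ee
        unfolding eq light_count_double by (simp add: light_count_double)
    next
      case oe
      have eq: "a + b = Suc (2 * (a' + b'))" using oe by simp
      show ?thesis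
        using IH[of "Suc a'" b' e] IH[of a' b' "e - 1"] 3 oe
        unfolding eq light_count_Suc_double by (simp add: light_count_double light_count_Suc_double del: light_count.simps)
    next
      case eo
      have eq: "a + b = Suc (2 * (a' + b'))" using eo by simp
      show ?thesis
        using IH[of a' "Suc b'" e] IH[of a' b' "e - 1"] 3 eo
        unfolding eq light_count_Suc_double by (simp add: light_count_double light_count_Suc_double del: light_count.simps)
    next
      case oo
      have eq: "a + b = 2 * Suc (a' + b')" using oo by simp
      have "light_count e (Suc a' + b') \<le> light_count e (Suc a') + light_count (e - 1) b'"
        by (rule IH) (use 3 oo in auto)
      moreover have "light_count (e - 1) (a' + Suc b')
          \<le> light_count (e - 1) a' + light_count (e - 1 - 1) (Suc b')"
        by (rule IH) (use 3 oo in auto)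
      \<comment> \<open>The two hypotheses place the extra number \<open>b'\<close> under the bound
        \<open>e - 2\<close>, the goal under \<open>e - 1\<close>; the weaker bound counts it
        whenever the stronger one does.\<close>
      moreover have "light_count (e - 1) b' + light_count (e - 1 - 1) (Suc b')
          \<le> light_count (e - 1) (Suc b') + light_count (e - 1 - 1) b'" by auto
      ultimately show ?thesis
        unfolding eq light_count_double unfolding oo light_count_Suc_double
        by (simp del: light_count.simps)
    qed
  qed
qed

text \<open>Numbers below \<open>2 ^ k\<close> with exactly \<open>e\<close> ones correspond to
  \<open>e\<close>-subsets of the \<open>k\<close> digit positions; the induction is Pascal's rule
  against \<open>light_count_double\<close>.\<close>

lemma binomial_le_light_count: "k choose e \<le> light_count (Suc e) (2 ^ k)"
proof (induction k arbitrary: e)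
  case 0
  show ?case by (cases e) auto
next
  case (Suc k)
  show ?case
  proof (cases e)
    case 0
    then show ?thesis using Suc[of 0] by (simp add: light_count_double)
  next
    case (Suc e')
    then show ?thesis using Suc.IH[of e] Suc.IH[of e'] by (simp add: light_count_double)
  qed
qed

text \<open>Take \<open>k\<close> as the integer part of \<open>log 2 t\<close>. If
  \<open>d \<le> k\<close>, then \<open>k + 1 \<le> 2 * k\<close>, which explains the factor 2 in
  the constant, and \<open>k choose d\<close> is at least \<open>(k / d) ^ d\<close>. If
  \<open>k < d\<close>, the left side is at most 1, and the number 0 is always counted.\<close>

lemma light_count_ge_log_power:
  assumes "d \<ge> 1" "t \<ge> 1"
  shows "\<exists>k. 2 ^ k \<le> t \<and> (1 / (2 * real d)) ^ d * log 2 (real t) ^ d \<le> real (light_count (Suc d) (2 ^ k))"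
proof -
  obtain k where k: "2 ^ k \<le> t" "t < 2 ^ (k + 1)"
    using ex_power_ivl1[of 2 t] assms by auto
  have l0: "0 \<le> log 2 (real t)" using assms by simp
  have lk: "log 2 (real t) \<le> real k + 1"
  proof -
    have "real t \<le> 2 powr (real k + 1)"
      using k(2) by (metis less_imp_le of_nat_1 of_nat_add of_nat_less_iff of_nat_numeral of_nat_power powr_realpow zero_less_numeral)
    then show ?thesis using assms by (subst log_le_iff) auto
  qed
  have eq: "(1 / (2 * real d)) ^ d * log 2 (real t) ^ d = (log 2 (real t) / (2 * real d)) ^ d"
    by (simp add: power_divide)
  show ?thesis
  proof (cases "d \<le> k")
    case True
    have "log 2 (real t) / (2 * real d) \<le> real k / real d"
      using lk True assms by (simp add: field_simps)
    then have "(log 2 (real t) / (2 * real d)) ^ d \<le> (real k / real d) ^ d"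
      using l0 by (intro power_mono) auto
    also have "\<dots> \<le> real (k choose d)"
      using binomial_ge_n_over_k_pow_k[OF True] by simp
    also have "\<dots> \<le> real (light_count (Suc d) (2 ^ k))"
      using binomial_le_light_count by simp
    finally show ?thesis using k eq by auto
  next
    case False
    then have "log 2 (real t) / (2 * real d) \<le> 1" using lk by (simp add: field_simps)
    then have "(log 2 (real t) / (2 * real d)) ^ d \<le> 1"
      using l0 by (intro power_le_one) auto
    moreover have "1 \<le> light_count (Suc d) (2 ^ k)"
      using light_count_mono[of 1 "2 ^ k" "Suc d"] by simp
    ultimately show ?thesis using k eq by force
  qed
qed

section \<open>Polynomials on the cube and their closure operator\<close>

text \<open>Extension by 0 picks one representative for each function on \<open>D\<close>, so that
  functions can be counted; \<open>mono_sum\<close> follows the same convention.\<close>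

definition supported :: "'x set \<Rightarrow> ('x \<Rightarrow> bit) set" where
  "supported D = {f. \<forall>x. x \<notin> D \<longrightarrow> f x = 0}"

definition low_sets :: "nat \<Rightarrow> nat \<Rightarrow> nat set set" where
  "low_sets n e = {S. S \<subseteq> {..<n} \<and> card S < e}"

definition mono_sum :: "nat \<Rightarrow> nat set set \<Rightarrow> bit list \<Rightarrow> bit" where
  "mono_sum n M x = (if x \<in> cube n then \<Sum>S\<in>M. \<Prod>i\<in>S. x ! i else 0)"

text \<open>Degree \<open>< e\<close> rather than \<open>\<le> d\<close>, so that the zero polynomial alone (\<open>e = 0\<close>) starts the induction on \<open>n\<close>.\<close>

definition polys0 :: "nat \<Rightarrow> nat \<Rightarrow> (bit list \<Rightarrow> bit) set" where
  "polys0 n e = mono_sum n ` Pow (low_sets n e)"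

lemma finite_cube: "finite (cube n)"
  and card_cube: "card (cube n) = 2 ^ n"
proof -
  have eq: "cube n = {xs. set xs \<subseteq> (UNIV :: bit set) \<and> length xs = n}" by (auto simp: cube_def)
  have "(UNIV :: bit set) = {0, 1}" by (auto intro: bit.exhaust)
  then have 2: "finite (UNIV :: bit set)" "card (UNIV :: bit set) = 2"
    by (metis finite.emptyI finite.insertI) (simp add: \<open>UNIV = {0, 1}\<close>)
  show "finite (cube n)" "card (cube n) = 2 ^ n"
    unfolding eq using finite_lists_length_eq[OF 2(1)] card_lists_length_eq[OF 2(1)] 2(2) by auto
qed

lemma finite_low_sets [simp]: "finite (low_sets n e)"
  by (rule finite_subset[of _ "Pow {..<n}"]) (auto simp: low_sets_def)

lemma finite_polys0: "finite (polys0 n e)"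
  and card_polys0_le: "card (polys0 n e) \<le> 2 ^ card (low_sets n e)"
  unfolding polys0_def using card_image_le[of "Pow (low_sets n e)" "mono_sum n"] by (auto simp: card_Pow)

lemma polys0_subset_polys: "polys0 n (Suc d) \<subseteq> polys n d"
proof
  fix f assume "f \<in> polys0 n (Suc d)"
  then obtain M where M: "M \<subseteq> low_sets n (Suc d)" "f = mono_sum n M" by (auto simp: polys0_def)
  then show "f \<in> polys n d"
    unfolding polys_def low_sets_def
    by (intro CollectI exI[of _ M]) (simp add: mono_sum_def less_Suc_eq_le)
qed

lemma polysE:
  assumes "f \<in> polys n d"
  obtains g where "g \<in> polys0 n (Suc d)" "\<And>x. x \<in> cube n \<Longrightarrow> f x = g x"
proof -
  obtain M where "M \<subseteq> low_sets n (Suc d)" "\<And>x. x \<in> cube n \<Longrightarrow> f x = (\<Sum>S\<in>M. \<Prod>i\<in>S. x ! i)"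
    using assms unfolding polys_def low_sets_def less_Suc_eq_le by blast
  then show ?thesis by (intro that[of "mono_sum n M"]) (simp_all add: polys0_def mono_sum_def)
qed

lemma polys0_supported: "polys0 n e \<subseteq> supported (cube n)"
  by (auto simp: polys0_def mono_sum_def supported_def)

lemma zero_in_polys0: "(\<lambda>x. 0) \<in> polys0 n e"
  unfolding polys0_def by (rule image_eqI[of _ _ "{}"]) (auto simp: mono_sum_def)

lemma polys0_add:
  assumes "f \<in> polys0 n e" "g \<in> polys0 n e"
  shows "(\<lambda>x. f x + g x) \<in> polys0 n e"
proof -
  obtain M N where M: "M \<subseteq> low_sets n e" "f = mono_sum n M" and N: "N \<subseteq> low_sets n e" "g = mono_sum n N"
    using assms by (auto simp: polys0_def)
  have fin: "finite M" "finite N" using M N finite_subset[OF _ finite_low_sets] by blast+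
  \<comment> \<open>Common monomials cancel modulo 2, which leaves the symmetric difference.\<close>
  have "sum h M + sum h N = sum h (M - N \<union> (N - M))" for h :: "nat set \<Rightarrow> bit"
  proof -
    have "sum h M = sum h (M - N) + sum h (M \<inter> N)" "sum h N = sum h (N - M) + sum h (M \<inter> N)"
      using sum.Int_Diff[OF fin(1), of h N] sum.Int_Diff[OF fin(2), of h M]
      by (metis add.commute Int_commute)+
    moreover have "sum h (M - N \<union> (N - M)) = sum h (M - N) + sum h (N - M)"
      using fin by (intro sum.union_disjoint) auto
    moreover have "p + i + (q + i) = p + q" for p q i :: bit by (cases p; cases q; cases i) simp_all
    ultimately show ?thesis by metis
  qed
  then have "(\<lambda>x. f x + g x) = mono_sum n (M - N \<union> (N - M))"
    unfolding M N mono_sum_def fun_eq_iff by simp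
  then show ?thesis using M N unfolding polys0_def by blast
qed

text \<open>Prepending a coordinate shifts the indices of all monomials by \<open>Suc\<close>;
  multiplication by the new coordinate adds the index 0 to those of \<open>h\<close>, raising their
  degree by one.\<close>

lemma polys0_Cons:
  assumes "g \<in> polys0 n (Suc e)" "h \<in> polys0 n e"
  shows "(\<lambda>x. case x of [] \<Rightarrow> 0 | b # y \<Rightarrow> g y + b * h y) \<in> polys0 (Suc n) (Suc e)"
proof -
  obtain M N where M: "M \<subseteq> low_sets n (Suc e)" "g = mono_sum n M" and N: "N \<subseteq> low_sets n e" "h = mono_sum n N"
    using assms by (auto simp: polys0_def)
  have fin: "finite M" "finite N" using M N finite_subset[OF _ finite_low_sets] by blast+
  let ?s = "\<lambda>S. Suc ` S" and ?z = "\<lambda>S. insert 0 (Suc ` S)"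
  have finS: "finite S" if "S \<in> M \<union> N" for S
    using that M N by (auto simp: low_sets_def intro: finite_subset)
  have inj: "inj_on ?s M" "inj_on ?z N"
    by (auto intro!: inj_onI simp: inj_image_eq_iff dest!: insert_ident[THEN iffD1, rotated 2])
  have disj: "?s ` M \<inter> ?z ` N = {}" by auto
  have "mono_sum (Suc n) (?s ` M \<union> ?z ` N) x = (case x of [] \<Rightarrow> 0 | b # y \<Rightarrow> g y + b * h y)" for x
  proof (cases x)
    case Nil then show ?thesis by (simp add: mono_sum_def cube_def)
  next
    case (Cons b y)
    have "(\<Sum>S\<in>?s ` M \<union> ?z ` N. \<Prod>i\<in>S. (b # y) ! i)
        = (\<Sum>S\<in>?s ` M. \<Prod>i\<in>S. (b # y) ! i) + (\<Sum>S\<in>?z ` N. \<Prod>i\<in>S. (b # y) ! i)"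
      using fin disj by (intro sum.union_disjoint) auto
    also have "(\<Sum>S\<in>?s ` M. \<Prod>i\<in>S. (b # y) ! i) = (\<Sum>S\<in>M. \<Prod>i\<in>S. y ! i)"
      by (subst sum.reindex[OF inj(1)]) (simp add: prod.reindex)
    also have "(\<Sum>S\<in>?z ` N. \<Prod>i\<in>S. (b # y) ! i) = (\<Sum>S\<in>N. b * (\<Prod>i\<in>S. y ! i))"
      unfolding sum.reindex[OF inj(2)]
      by (rule sum.cong) (auto simp: prod.reindex finS)
    also have "\<dots> = b * (\<Sum>S\<in>N. \<Prod>i\<in>S. y ! i)" by (rule sum_distrib_left [symmetric])
    finally have eq: "(\<Sum>S\<in>?s ` M \<union> ?z ` N. \<Prod>i\<in>S. (b # y) ! i)
        = (\<Sum>S\<in>M. \<Prod>i\<in>S. y ! i) + b * (\<Sum>S\<in>N. \<Prod>i\<in>S. y ! i)" .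
    show ?thesis
    proof (cases "y \<in> cube n")
      case True
      then have "x \<in> cube (Suc n)" using Cons by (simp add: cube_def)
      then show ?thesis
        unfolding Cons mono_sum_def list.case M N if_P[OF True] using eq by (simp only: if_True)
    next
      case False
      then have "x \<notin> cube (Suc n)" using Cons by (simp add: cube_def)
      then show ?thesis unfolding Cons mono_sum_def list.case M N if_not_P[OF False] by simp
    qed
  qed
  moreover have "?s ` M \<union> ?z ` N \<subseteq> low_sets (Suc n) (Suc e)"
    using M N finS by (auto simp: low_sets_def card_image card_insert_if subset_iff)
  ultimately show ?thesis unfolding polys0_def by (intro image_eqI[of _ _ "?s ` M \<union> ?z ` N"] ext) simp_all
qed

text \<open>A family with distinct restrictions to \<open>Y\<close> expresses, by counting, that the
  restrictions span dimension at least \<open>light_count e (card Y)\<close>. Both \<open>e\<close>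
  and \<open>Y\<close> vary in the induction, as it passes to a lower degree and to the union and
  intersection of two slices.\<close>

lemma polys0_separates:
  "Y \<subseteq> cube n \<Longrightarrow> \<exists>F\<subseteq>polys0 n e. 2 ^ light_count e (card Y) \<le> card F \<and> inj_on (\<lambda>f. restrict f Y) F"
proof (induction n arbitrary: e Y)
  case 0
  then have Y: "Y = {} \<or> Y = {[]}" by (auto simp: cube_def)
  show ?case
  proof (cases "e = 0 \<or> Y = {}")
    case True
    then show ?thesis by (intro exI[of _ "{\<lambda>x. 0}"]) (auto simp: zero_in_polys0)
  next
    case False
    have "mono_sum 0 {{}} \<in> polys0 0 e"
      using False unfolding polys0_def by (intro imageI) (simp add: low_sets_def)
    moreover have "mono_sum 0 {{}} [] \<noteq> (0 :: bit)" by (simp add: mono_sum_def cube_def)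
    then have ne: "restrict (mono_sum 0 {{}}) {[]} \<noteq> restrict (\<lambda>x. 0) {[]}"
      by (metis restrict_apply singletonI)
    moreover have "mono_sum 0 {{}} \<noteq> (\<lambda>x. 0)" using ne by auto
    moreover have "Y = {[]}" "light_count e (card Y) = 1"
      using False Y by auto
    moreover have "inj_on (\<lambda>f. restrict f {[]}) {mono_sum 0 {{}}, \<lambda>x. 0}"
      using ne by (metis (no_types, lifting) inj_onI insertE singletonD)
    ultimately show ?thesis
      by (intro exI[of _ "{mono_sum 0 {{}}, \<lambda>x. 0}"])
        (simp add: zero_in_polys0 del: inj_on_insert restrict_apply)
  qed
next
  case (Suc n)
  show ?case
  proof (cases e)
    case 0
    then show ?thesis by (intro exI[of _ "{\<lambda>x. 0}"]) (auto simp: zero_in_polys0)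
  next
    case e: (Suc e')
    define Y0 Y1 where "Y0 = {y. 0 # y \<in> Y}" and "Y1 = {y. 1 # y \<in> Y}"
    have sub: "Y0 \<subseteq> cube n" "Y1 \<subseteq> cube n" using Suc.prems by (auto simp: Y0_def Y1_def cube_def)
    have fin: "finite Y0" "finite Y1" using sub finite_subset[OF _ finite_cube] by blast+
    have Y: "Y = Cons 0 ` Y0 \<union> Cons 1 ` Y1"
    proof (rule set_eqI)
      fix x
      show "x \<in> Y \<longleftrightarrow> x \<in> Cons 0 ` Y0 \<union> Cons 1 ` Y1"
      proof (cases x)
        case Nil then show ?thesis using Suc.prems by (auto simp: cube_def)
      next
        case (Cons b y) then show ?thesis by (cases b) (auto simp: Y0_def Y1_def)
      qed
    qed
    have "card Y = card Y0 + card Y1"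
      unfolding Y by (subst card_Un_disjoint) (use fin in \<open>auto simp: card_image\<close>)
    then have cY: "card Y = card (Y0 \<union> Y1) + card (Y0 \<inter> Y1)"
      using card_Un_Int[OF fin] by simp
    obtain G where G: "G \<subseteq> polys0 n e" "2 ^ light_count e (card (Y0 \<union> Y1)) \<le> card G"
      "inj_on (\<lambda>f. restrict f (Y0 \<union> Y1)) G" using Suc.IH[OF Un_least[OF sub], of e] by blast
    obtain H where H: "H \<subseteq> polys0 n e'" "2 ^ light_count e' (card (Y0 \<inter> Y1)) \<le> card H"
      "inj_on (\<lambda>f. restrict f (Y0 \<inter> Y1)) H" using Suc.IH[OF le_infI1[OF sub(1), of Y1], of e'] by blast
    define L :: "(bit list \<Rightarrow> bit) \<times> (bit list \<Rightarrow> bit) \<Rightarrow> bit list \<Rightarrow> bit"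
      where "L = (\<lambda>(g, h) x. case x of [] \<Rightarrow> 0 | b # y \<Rightarrow> g y + b * h y)"
    have L_Cons: "L (g, h) (b # y) = g y + b * h y" for g h b y
      by (simp only: L_def prod.case list.case)
    have inj: "inj_on ((\<lambda>f. restrict f Y) \<circ> L) (G \<times> H)"
    proof (rule inj_onI, clarify)
      fix g h g' h'
      assume gh: "g \<in> G" "h \<in> H" "g' \<in> G" "h' \<in> H"
        and "((\<lambda>f. restrict f Y) \<circ> L) (g, h) = ((\<lambda>f. restrict f Y) \<circ> L) (g', h')"
      then have eq: "L (g, h) x = L (g', h') x" if "x \<in> Y" for x
        using that by (metis comp_apply restrict_apply)
      \<comment> \<open>The slice at 0 fixes \<open>g\<close> on \<open>Y0\<close>, the slice at 1
        fixes \<open>g + h\<close> on \<open>Y1\<close>. Hence \<open>h\<close> is fixed on the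
        intersection, so everywhere by the choice of \<open>H\<close>, and then \<open>g\<close> is
        fixed on the whole union.\<close>
      have 0: "g y = g' y" if "y \<in> Y0" for y using eq[of "0 # y"] that
        by (simp only: Y0_def L_Cons mem_Collect_eq mult_zero_left add_0_right)
      have 1: "g y + h y = g' y + h' y" if "y \<in> Y1" for y
        using eq[of "1 # y"] that by (simp only: Y1_def L_Cons mem_Collect_eq mult_1)
      have "restrict h (Y0 \<inter> Y1) = restrict h' (Y0 \<inter> Y1)"
        using 0 1 by (intro restrict_ext) (metis IntE add_left_cancel)
      then have h: "h = h'" using H(3) gh by (auto dest: inj_onD)
      then have "restrict g (Y0 \<union> Y1) = restrict g' (Y0 \<union> Y1)"
        using 0 1 by (intro restrict_ext) (metis UnE add_right_cancel)
      then have "g = g'" using G(3) gh by (auto dest: inj_onD)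
      with h show "g = g' \<and> h = h'" by simp
    qed
    have "light_count e (card Y) \<le> light_count e (card (Y0 \<union> Y1)) + light_count e' (card (Y0 \<inter> Y1))"
      unfolding cY using light_count_add[of "card (Y0 \<inter> Y1)" "card (Y0 \<union> Y1)" e] fin e
      by (simp add: card_mono le_infI1)
    then have "(2::nat) ^ light_count e (card Y)
        \<le> 2 ^ light_count e (card (Y0 \<union> Y1)) * 2 ^ light_count e' (card (Y0 \<inter> Y1))"
      by (simp flip: power_add)
    also have "\<dots> \<le> card G * card H" using G H by (intro mult_mono) auto
    also have "\<dots> = card (L ` (G \<times> H))"
      using inj_on_imageI2[OF inj] by (simp add: card_image card_cartesian_product)
    finally have "2 ^ light_count e (card Y) \<le> card (L ` (G \<times> H))" .
    moreover have "L ` (G \<times> H) \<subseteq> polys0 (Suc n) e"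
      using G(1) H(1) polys0_Cons[of _ n e'] by (auto simp: L_def e)
    moreover have "inj_on (\<lambda>f. restrict f Y) (L ` (G \<times> H))"
      using inj by (rule inj_on_imageI)
    ultimately show ?thesis by blast
  qed
qed

text \<open>Since \<open>polys0\<close> is closed under addition, a value at \<open>y\<close> is
  determined by the values on \<open>X\<close> exactly when vanishing on \<open>X\<close> forces
  vanishing at \<open>y\<close>.\<close>

definition poly_closure :: "nat \<Rightarrow> nat \<Rightarrow> bit list set \<Rightarrow> bit list set" where
  "poly_closure n e X = {y \<in> cube n. \<forall>f\<in>polys0 n e. (\<forall>x\<in>X. f x = 0) \<longrightarrow> f y = 0}"

text \<open>Polynomials that agree on \<open>X\<close> agree on its closure, so a family separated
  by the closure has at most \<open>2 ^ card X\<close> members.\<close>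

lemma light_count_card_poly_closure_le:
  assumes "finite X"
  shows "light_count e (card (poly_closure n e X)) \<le> card X"
proof -
  let ?Y = "poly_closure n e X"
  obtain F where F: "F \<subseteq> polys0 n e" "2 ^ light_count e (card ?Y) \<le> card F"
    "inj_on (\<lambda>f. restrict f ?Y) F"
    using polys0_separates[of ?Y n e] by (auto simp: poly_closure_def)
  have "inj_on (\<lambda>f. {x \<in> X. f x = 1}) F"
  proof (rule inj_onI)
    fix f g assume fg: "f \<in> F" "g \<in> F" and eq: "{x \<in> X. f x = 1} = {x \<in> X. g x = 1}"
    have X: "f x + g x = 0" if "x \<in> X" for x
    proof -
      have "f x = 1 \<longleftrightarrow> g x = 1" using eq that by blast
      then show ?thesis by (cases "f x"; cases "g x") auto
    qed
    have "f y = g y" if "y \<in> ?Y" for y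
    proof -
      have "(\<lambda>x. f x + g x) \<in> polys0 n e" using fg F polys0_add by blast
      then have "f y + g y = 0" using that X unfolding poly_closure_def by fastforce
      then show ?thesis by (cases "f y"; cases "g y") auto
    qed
    then have "restrict f ?Y = restrict g ?Y" by (intro restrict_ext)
    then show "f = g" using F(3) fg by (auto dest: inj_onD)
  qed
  then have "card F \<le> card (Pow X)" using assms by (intro card_inj_on_le) auto
  then have "(2::nat) ^ light_count e (card ?Y) \<le> 2 ^ card X"
    using F(2) assms by (simp only: card_Pow)
  then show ?thesis by (rule power_le_imp_le_exp[rotated]) simp
qed

section \<open>Most functions are far from low-degree polynomials\<close>

lemma card_low_sets_le: "card (low_sets n (Suc d)) \<le> Suc d * (n + 1) ^ d"
proof -
  have "low_sets n (Suc d) = (\<Union>i\<le>d. {S. S \<subseteq> {..<n} \<and> card S = i})"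
    by (auto simp: low_sets_def)
  also have "card \<dots> \<le> (\<Sum>i\<le>d. card {S. S \<subseteq> {..<n} \<and> card S = i})"
    by (rule card_UN_le) simp
  also have "\<dots> = (\<Sum>i\<le>d. n choose i)" by (simp add: n_subsets)
  also have "\<dots> \<le> (\<Sum>i\<le>d. (n + 1) ^ d)"
  proof (rule sum_mono)
    fix i assume i: "i \<in> {..d}"
    have "n choose i \<le> n ^ i" by (cases "i \<le> n") (simp_all add: binomial_le_pow binomial_eq_0)
    also have "\<dots> \<le> (n + 1) ^ i" by (rule power_mono) auto
    also have "\<dots> \<le> (n + 1) ^ d" using i by (intro power_increasing) auto
    finally show "n choose i \<le> (n + 1) ^ d" .
  qed
  finally show ?thesis by simp
qed

lemma bij_betw_supported_Pow: "bij_betw (\<lambda>f. {x \<in> D. f x = 1}) (supported D) (Pow D)"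
proof (rule bij_betwI')
  fix f g assume fg: "f \<in> supported D" "g \<in> supported D"
  show "({x \<in> D. f x = 1} = {x \<in> D. g x = 1}) = (f = g)"
  proof
    assume eq: "{x \<in> D. f x = 1} = {x \<in> D. g x = 1}"
    show "f = g"
    proof
      fix x
      have "x \<in> D \<Longrightarrow> f x = 1 \<longleftrightarrow> g x = 1" using eq by blast
      then show "f x = g x"
        using fg by (cases "x \<in> D"; cases "f x"; cases "g x") (simp_all add: supported_def)
    qed
  qed simp
next
  fix S assume "S \<in> Pow D"
  then show "\<exists>f\<in>supported D. S = {x \<in> D. f x = 1}"
    by (intro bexI[of _ "\<lambda>x. if x \<in> S then 1 else 0"]) (auto simp: supported_def)
qed auto

lemma finite_supported: "finite D \<Longrightarrow> finite (supported D)"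
  and card_supported: "finite D \<Longrightarrow> card (supported D) = 2 ^ card D"
  using bij_betw_finite[OF bij_betw_supported_Pow[of D]] bij_betw_same_card[OF bij_betw_supported_Pow[of D]]
  by (simp_all add: card_Pow)

text \<open>A Chernoff bound: every counted set \<open>S\<close> is weighted with \<open>(1/2) ^ card S\<close>.\<close>

lemma card_small_subsets_le:
  assumes "finite D"
  shows "real (card {S. S \<subseteq> D \<and> 3 * card S < card D}) \<le> (3 / 2) ^ card D * 2 powr (card D / 3)"
proof -
  let ?A = "{S. S \<subseteq> D \<and> 3 * card S < card D}"
  have "real (card ?A) * 2 powr (- (card D / 3)) = (\<Sum>S\<in>?A. 2 powr (- (card D / 3)))" by simp
  also have "\<dots> \<le> (\<Sum>S\<in>?A. (1 / 2) ^ card S)"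
  proof (rule sum_mono)
    fix S assume "S \<in> ?A"
    then have "2 powr (- (card D / 3)) \<le> 2 powr (- real (card S))" by (intro powr_mono) auto
    then show "2 powr (- (card D / 3)) \<le> (1 / 2 :: real) ^ card S"
      by (simp add: powr_minus powr_realpow power_one_over inverse_eq_divide)
  qed
  also have "\<dots> \<le> (\<Sum>S\<in>Pow D. (1 / 2) ^ card S)"
    using assms by (intro sum_mono2) auto
  also have "\<dots> = (3 / 2) ^ card D"
    using prod_add[OF assms, of "\<lambda>_. 1 / 2 :: real" "\<lambda>_. 1"] by simp
  finally show ?thesis by (simp add: powr_minus field_simps)
qed

lemma card_hamming_ball_le:
  assumes "finite D"
  shows "real (card {f \<in> supported D. 3 * card {x \<in> D. f x \<noteq> g x} < card D})
    \<le> (3 / 2) ^ card D * 2 powr (card D / 3)"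
proof -
  let ?B = "{f \<in> supported D. 3 * card {x \<in> D. f x \<noteq> g x} < card D}"
  have "inj_on (\<lambda>f. {x \<in> D. f x \<noteq> g x}) ?B"
  proof (rule inj_onI, rule ext)
    fix f f' x
    assume f: "f \<in> ?B" "f' \<in> ?B" and eq: "{x \<in> D. f x \<noteq> g x} = {x \<in> D. f' x \<noteq> g x}"
    have "x \<in> D \<Longrightarrow> f x \<noteq> g x \<longleftrightarrow> f' x \<noteq> g x" using eq by blast
    then show "f x = f' x"
      using f by (cases "x \<in> D"; cases "f x"; cases "f' x"; cases "g x") (simp_all add: supported_def)
  qed
  then have "card ?B \<le> card {S. S \<subseteq> D \<and> 3 * card S < card D}"
    using assms by (intro card_inj_on_le) auto
  then show ?thesis using card_small_subsets_le[OF assms] by linarith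
qed

text \<open>Each ball has at most \<open>(3/2 * 2 powr (1/3)) ^ N\<close> functions, where
  \<open>N = 2 ^ n\<close>. The cube of this base is \<open>27/4 < 8\<close>, which leaves a gain of
  \<open>(32/27) powr (N/3)\<close> over \<open>2 ^ N\<close>; the logarithm of the number of
  polynomials is only polynomial in \<open>n\<close>.\<close>

lemma eventually_few_functions_near_polys:
  "eventually (\<lambda>n. 3 * (2 ^ card (low_sets n (Suc d)) * ((3 / 2) ^ card (cube n) * 2 powr (card (cube n) / 3)))
    < (2 :: real) ^ card (cube n)) at_top"
proof -
  have pos: "ln (32 / 27 :: real) > 0" by simp
  have "((\<lambda>n. (ln 3 + real (Suc d) * (real n + 1) ^ d * ln 2) / 2 ^ n) \<longlongrightarrow> 0) at_top"
    by real_asymp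
  then have "eventually (\<lambda>n. (ln 3 + real (Suc d) * (real n + 1) ^ d * ln 2) / 2 ^ n < ln (32 / 27) / 3) at_top"
    by (rule order_tendstoD) (use pos in simp)
  then show ?thesis
  proof eventually_elim
    case (elim n)
    let ?N = "(2 :: real) ^ n" and ?m = "card (low_sets n (Suc d))"
    have m: "real ?m \<le> real (Suc d) * (real n + 1) ^ d"
      using card_low_sets_le[of n d] by (metis of_nat_1 of_nat_add of_nat_le_iff of_nat_mult of_nat_power)
    have "ln 3 + real (Suc d) * (real n + 1) ^ d * ln 2 < ?N * (ln (32 / 27) / 3)"
      using elim by (simp add: divide_less_eq mult.commute)
    moreover have "real ?m * ln 2 \<le> real (Suc d) * (real n + 1) ^ d * ln 2"
      using m by (intro mult_right_mono) auto
    ultimately have less: "ln 3 + real ?m * ln 2 < ?N * (ln (32 / 27) / 3)" by linarith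
    have ln1: "ln (32 / 27 :: real) = 5 * ln 2 - 3 * ln 3"
      using ln_div[of 32 27] ln_realpow[of 2 5] ln_realpow[of 3 3] by simp
    have ln2: "ln (3 / 2 :: real) = ln 3 - ln 2" by (simp add: ln_div)
    have "ln 3 + (real ?m * ln 2 + (?N * ln (3 / 2) + ?N / 3 * ln 2)) < ?N * ln 2"
      using less unfolding ln1 ln2 by (simp add: algebra_simps)
    then have "ln (3 * (2 ^ ?m * ((3 / 2) ^ card (cube n) * 2 powr (card (cube n) / 3))))
        < ln ((2 :: real) ^ card (cube n))"
      by (simp add: ln_mult ln_realpow ln_powr card_cube)
    then show ?case by (subst (asm) ln_less_cancel_iff) auto
  qed
qed

lemma card_not_far_from_polys_le:
  assumes "\<epsilon> \<le> 1 / 3"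
  shows "real (card {f \<in> supported (cube n). \<not> far_from (cube n) \<epsilon> (polys n d) f})
    \<le> 2 ^ card (low_sets n (Suc d)) * ((3 / 2) ^ card (cube n) * 2 powr (card (cube n) / 3))"
proof -
  let ?D = "cube n"
  let ?B = "\<lambda>g. {f \<in> supported ?D. 3 * card {x \<in> ?D. f x \<noteq> g x} < card ?D}"
  have fin: "finite (\<Union>g\<in>polys0 n (Suc d). ?B g)"
    using finite_polys0 finite_supported[OF finite_cube] by auto
  have "{f \<in> supported ?D. \<not> far_from ?D \<epsilon> (polys n d) f} \<subseteq> (\<Union>g\<in>polys0 n (Suc d). ?B g)"
  proof (clarsimp simp: far_from_def not_le)
    fix f g assume f: "f \<in> supported ?D" and g: "g \<in> polys n d"
      and less: "real (card {x \<in> ?D. f x \<noteq> g x}) < \<epsilon> * real (card ?D)"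
    obtain h where h: "h \<in> polys0 n (Suc d)" "\<And>x. x \<in> ?D \<Longrightarrow> g x = h x" using polysE[OF g] by blast
    have "{x \<in> ?D. f x \<noteq> g x} = {x \<in> ?D. f x \<noteq> h x}" using h(2) by auto
    moreover have "\<epsilon> * real (card ?D) \<le> 1 / 3 * real (card ?D)" using assms by (intro mult_right_mono) auto
    ultimately have "3 * card {x \<in> ?D. f x \<noteq> h x} < card ?D" using less by simp
    then show "\<exists>h\<in>polys0 n (Suc d). 3 * card {x \<in> ?D. f x \<noteq> h x} < card ?D" using h by blast
  qed
  then have "card {f \<in> supported ?D. \<not> far_from ?D \<epsilon> (polys n d) f} \<le> card (\<Union>g\<in>polys0 n (Suc d). ?B g)"
    using fin by (rule card_mono[rotated])
  also have "\<dots> \<le> (\<Sum>g\<in>polys0 n (Suc d). card (?B g))"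
    by (rule card_UN_le[OF finite_polys0])
  finally have "real (card {f \<in> supported ?D. \<not> far_from ?D \<epsilon> (polys n d) f})
      \<le> (\<Sum>g\<in>polys0 n (Suc d). real (card (?B g)))" by (simp flip: of_nat_sum)
  also have "\<dots> \<le> (\<Sum>g\<in>polys0 n (Suc d). (3 / 2) ^ card ?D * 2 powr (card ?D / 3))"
    by (intro sum_mono card_hamming_ball_le finite_cube)
  also have "\<dots> = real (card (polys0 n (Suc d))) * ((3 / 2) ^ card ?D * 2 powr (card ?D / 3))" by simp
  also have "\<dots> \<le> 2 ^ card (low_sets n (Suc d)) * ((3 / 2) ^ card ?D * 2 powr (card ?D / 3))"
    using card_polys0_le[of n "Suc d"] by (intro mult_right_mono) (simp_all flip: of_nat_le_iff)
  finally show ?thesis .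
qed

section \<open>The erasure adversary\<close>

text \<open>The erased set depends on the queries alone, so inputs that have given the same answers
  also see the same erasures.\<close>

definition erasure_strategy :: "('x list \<Rightarrow> 'x set) \<Rightarrow> ('x \<Rightarrow> 'v) \<Rightarrow> ('x, 'v) strategy" where
  "erasure_strategy E f = (\<lambda>qs y. if y \<in> E qs then None else Some (f y))"

text \<open>Invariant of the inputs consistent with the answers at \<open>X\<close>: when
  \<open>K\<close> is a linear space, they form a union of cosets of its subspace vanishing on
  \<open>X\<close>.\<close>

definition translation_closed :: "('x \<Rightarrow> bit) set \<Rightarrow> 'x set \<Rightarrow> ('x \<Rightarrow> bit) set \<Rightarrow> bool" where
  "translation_closed K X V \<longleftrightarrow> (\<forall>f\<in>V. \<forall>g\<in>K. (\<forall>x\<in>X. g x = 0) \<longrightarrow> (\<lambda>x. f x + g x) \<in> V)"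

lemma translation_closed_value:
  assumes "translation_closed K X V"
  shows "translation_closed K (insert x X) {f \<in> V. f x = b}"
  using assms unfolding translation_closed_def by simp

text \<open>Adding \<open>g\<close> maps the functions with value \<open>b\<close> at
  \<open>x\<close> injectively to those with value \<open>b + 1\<close>, and conversely.\<close>

lemma card_value_eq:
  assumes "translation_closed K X V" "finite V" "g \<in> K" "\<forall>y\<in>X. g y = 0" "g x = 1"
  shows "card V = 2 * card {f \<in> V. f x = b}"
proof -
  have le: "card {f \<in> V. f x = b} \<le> card {f \<in> V. f x = b + 1}" for b
  proof (rule card_inj_on_le)
    show "inj_on (\<lambda>f y. f y + g y) {f \<in> V. f x = b}"
      by (intro inj_onI ext) (metis add_right_cancel)
    show "(\<lambda>f y. f y + g y) ` {f \<in> V. f x = b} \<subseteq> {f \<in> V. f x = b + 1}"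
      using assms unfolding translation_closed_def by (simp add: image_subset_iff)
  qed (use assms in simp)
  have "b + 1 + 1 = b" by (cases b) simp_all
  then have eq: "card {f \<in> V. f x = b} = card {f \<in> V. f x = b + 1}"
    using le[of b] le[of "b + 1"] by simp
  have "V = {f \<in> V. f x = b} \<union> {f \<in> V. f x = b + 1}"
  proof -
    have "c = b \<or> c = b + 1" for c by (cases b; cases c) simp_all
    then show ?thesis by blast
  qed
  moreover have "{f \<in> V. f x = b} \<inter> {f \<in> V. f x = b + 1} = {}"
    by (cases b) auto
  ultimately have "card V = card {f \<in> V. f x = b} + card {f \<in> V. f x = b + 1}"
    using assms(2) by (metis (no_types, lifting) card_Un_disjoint finite_Un)
  then show ?thesis using eq by simp
qed

section \<open>Equal acceptance proportions over two families of inputs\<close>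

text \<open>
  At every unerased query \<open>x\<close>, some translation in \<open>K\<close> flips the value at \<open>x\<close> and preserves those at
  the earlier queries, so each answer splits both \<open>V\<close> and \<open>W\<close> into halves.
\<close>

lemma card_accepting_eq:
  fixes V W :: "('x \<Rightarrow> bit) set"
  assumes indep: "\<And>qs x. length qs \<le> q \<Longrightarrow> set qs \<subseteq> D \<Longrightarrow> x \<in> D \<Longrightarrow> x \<notin> E qs \<Longrightarrow>
      \<exists>g\<in>K. (\<forall>y\<in>set qs. g y = 0) \<and> g x = 1"
  shows "finite V \<Longrightarrow> finite W \<Longrightarrow> translation_closed K (set qs) V \<Longrightarrow> translation_closed K (set qs) W
    \<Longrightarrow> set qs \<subseteq> D \<Longrightarrow> queries_in D a
    \<Longrightarrow> (\<And>f. f \<in> V \<union> W \<Longrightarrow> length (fst (run (erasure_strategy E f) a qs)) \<le> q)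
    \<Longrightarrow> card {f \<in> V. snd (run (erasure_strategy E f) a qs)} * card W
      = card {f \<in> W. snd (run (erasure_strategy E f) a qs)} * card V"
proof (induction a arbitrary: V W qs)
  case (Halt b)
  then show ?case by (cases b) (simp_all add: mult.commute)
next
  case (Query x k)
  have x: "x \<in> D" and k: "\<And>r. queries_in D (k r)" using Query.prems(6) by auto
  have qs: "set (qs @ [x]) \<subseteq> D" "set (qs @ [x]) = insert x (set qs)" using x Query.prems(5) by auto
  show ?case
  \<comment> \<open>The query bound speaks only of runs on inputs in \<open>V\<close> or
    \<open>W\<close>; one such run is needed to see that \<open>qs\<close> is short enough for
    \<open>indep\<close>.\<close>
  proof (cases "V \<union> W = {}")
    case True
    then show ?thesis by simp
  next
    case False
    then obtain f where f: "f \<in> V \<union> W" by blast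
    have len: "length qs \<le> length (fst (run A a qs))" for A :: "('x, bit) strategy" and a
    proof (induction a arbitrary: qs)
      case (Query y l)
      show ?case using Query[of "l (A qs y)" "qs @ [y]"] by simp
    qed simp
    have q: "length qs \<le> q" using Query.prems(7)[OF f] len le_trans by blast
    show ?thesis
    proof (cases "x \<in> E qs")
      case True
      \<comment> \<open>An erased answer conditions on nothing: both families stay as they are, and
        fewer translations remain to be respected.\<close>
      have "translation_closed K (insert x (set qs)) V" "translation_closed K (insert x (set qs)) W"
        using Query.prems(3,4) by (auto simp: translation_closed_def)
      then have "card {f \<in> V. snd (run (erasure_strategy E f) (k None) (qs @ [x]))} * card W
        = card {f \<in> W. snd (run (erasure_strategy E f) (k None) (qs @ [x]))} * card V"
        using Query.prems True k qs by (intro Query.IH) (auto simp: erasure_strategy_def)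
      then show ?thesis using True by (simp add: erasure_strategy_def)
    next
      case False
      obtain g where g: "g \<in> K" "\<forall>y\<in>set qs. g y = 0" "g x = 1"
        using indep[OF q Query.prems(5) x False] by blast
      define R where "R = (\<lambda>f b. snd (run (erasure_strategy E f) (k (Some b)) (qs @ [x])))"
      have run: "run (erasure_strategy E f) (Query x k) qs
          = run (erasure_strategy E f) (k (Some (f x))) (qs @ [x])" for f
        using False by (simp add: erasure_strategy_def)
      have half: "card U = 2 * card {f \<in> U. f x = b}" if "U = V \<or> U = W" for U b
        using that card_value_eq[OF Query.prems(3,1) g] card_value_eq[OF Query.prems(4,2) g] by blast
      have IH: "card {f \<in> V. f x = b \<and> R f b} * card {f \<in> W. f x = b}
          = card {f \<in> W. f x = b \<and> R f b} * card {f \<in> V. f x = b}" for b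
      proof -
        have "card {f \<in> {f \<in> V. f x = b}. R f b} * card {f \<in> W. f x = b}
          = card {f \<in> {f \<in> W. f x = b}. R f b} * card {f \<in> V. f x = b}"
          unfolding R_def
        proof (rule Query.IH)
          show "translation_closed K (set (qs @ [x])) {f \<in> V. f x = b}"
            "translation_closed K (set (qs @ [x])) {f \<in> W. f x = b}"
            unfolding qs(2) using Query.prems(3,4) by (simp_all add: translation_closed_value)
          fix f assume "f \<in> {f \<in> V. f x = b} \<union> {f \<in> W. f x = b}"
          then have "f \<in> V \<union> W" "f x = b" by auto
          then show "length (fst (run (erasure_strategy E f) (k (Some b)) (qs @ [x]))) \<le> q"
            using Query.prems(7)[of f] run[of f] by simp
        qed (use Query.prems k qs in auto)
        then show ?thesis by (simp add: conj_assoc)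
      qed
      have split: "card {f \<in> U. R f (f x)}
          = card {f \<in> U. f x = 0 \<and> R f 0} + card {f \<in> U. f x = 1 \<and> R f 1}" if "finite U" for U
      proof -
        have "{f \<in> U. R f (f x)} = {f \<in> U. f x = 0 \<and> R f 0} \<union> {f \<in> U. f x = 1 \<and> R f 1}"
        proof -
          have "R f (f x) \<longleftrightarrow> f x = 0 \<and> R f 0 \<or> f x = 1 \<and> R f 1" for f
            by (cases "f x") simp_all
          then show ?thesis by blast
        qed
        then show ?thesis
          using that by (simp only:) (subst card_Un_disjoint, auto)
      qed
      have "card {f \<in> V. R f (f x)} * card W
          = 2 * (card {f \<in> V. f x = 0 \<and> R f 0} * card {f \<in> W. f x = 0}
            + card {f \<in> V. f x = 1 \<and> R f 1} * card {f \<in> W. f x = 1})"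
        using split[OF Query.prems(1)] half[of W 0] half[of W 1] by (simp add: algebra_simps)
      also have "\<dots> = 2 * (card {f \<in> W. f x = 0 \<and> R f 0} * card {f \<in> V. f x = 0}
            + card {f \<in> W. f x = 1 \<and> R f 1} * card {f \<in> V. f x = 1})"
        using IH[of 0] IH[of 1] by simp
      also have "\<dots> = card {f \<in> W. R f (f x)} * card V"
        using split[OF Query.prems(2)] half[of V 0] half[of V 1] by (simp add: algebra_simps)
      finally show ?thesis unfolding run R_def .
    qed
  qed
qed

text \<open>Exchanging inputs and coins allows each deterministic tree to be treated
  separately.\<close>

lemma sum_prob_eq_expectation_card:
  assumes "finite F"
  shows "(\<Sum>f\<in>F. measure_pmf.prob T {a. Q f a})
    = measure_pmf.expectation T (\<lambda>a. real (card {f \<in> F. Q f a}))"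
proof -
  have "(\<Sum>f\<in>F. measure_pmf.prob T {a. Q f a})
      = (\<Sum>f\<in>F. measure_pmf.expectation T (indicator {a. Q f a}))" by simp
  also have "\<dots> = measure_pmf.expectation T (\<lambda>a. \<Sum>f\<in>F. indicator {a. Q f a} a)"
    by (rule Bochner_Integration.integral_sum [symmetric])
      (auto intro!: measure_pmf.integrable_const_bound[where B = 1])
  also have "(\<lambda>a. \<Sum>f\<in>F. indicator {a. Q f a} a) = (\<lambda>a. real (card {f \<in> F. Q f a}))"
    using assms by (simp add: indicator_def sum.If_cases Int_def)
  finally show ?thesis .
qed

section \<open>The closure-erasing adversary and the query bound\<close>

text \<open>
  Closures of more than \<open>t\<close> points are skipped, since the adversary has to respect its rate for all
  lists of queries, even for those longer than the tester ever makes.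
\<close>

definition closure_erasures :: "nat \<Rightarrow> nat \<Rightarrow> nat \<Rightarrow> bit list list \<Rightarrow> bit list set" where
  "closure_erasures n e t qs =
     (\<Union>ps\<in>{ps. prefix ps qs \<and> card (poly_closure n e (set ps)) \<le> t}. poly_closure n e (set ps))"

lemma finite_poly_closure: "finite (poly_closure n e X)"
  by (rule finite_subset[OF _ finite_cube]) (auto simp: poly_closure_def)

lemma closure_erasures_snoc:
  "closure_erasures n e t (qs @ [x]) = closure_erasures n e t qs \<union>
     (if card (poly_closure n e (insert x (set qs))) \<le> t then poly_closure n e (insert x (set qs)) else {})"
proof -
  have "{ps. prefix ps (qs @ [x]) \<and> card (poly_closure n e (set ps)) \<le> t}
    = {ps. prefix ps qs \<and> card (poly_closure n e (set ps)) \<le> t} \<union>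
      (if card (poly_closure n e (insert x (set qs))) \<le> t then {qs @ [x]} else {})"
    by (auto simp: prefix_snoc)
  then show ?thesis unfolding closure_erasures_def by simp
qed

text \<open>The constant 1 has degree 0 and vanishes nowhere, so no value is determined before the
  first query, and the first oracle is the input itself.\<close>

lemma closure_erasures_Nil: "closure_erasures n (Suc d) t [] = {}"
proof -
  have "mono_sum n {{}} \<in> polys0 n (Suc d)"
    unfolding polys0_def by (intro imageI) (simp add: low_sets_def)
  moreover have "mono_sum n {{}} y = 1" if "y \<in> cube n" for y using that by (simp add: mono_sum_def)
  ultimately have "poly_closure n (Suc d) {} = {}" unfolding poly_closure_def by force
  then show ?thesis unfolding closure_erasures_def by simp
qed

lemma erasure_strategy_adversary:
  "erasure_strategy (closure_erasures n (Suc d) t) f \<in> fixed_rate_erasure_adversary (cube n) (real t) f"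
proof -
  let ?E = "closure_erasures n (Suc d) t"
  let ?S = "erasure_strategy ?E f"
  have dist: "oracle_dist (cube n) (?S qs) (?S (qs @ [x])) \<le> t" for qs x
  proof -
    let ?C = "poly_closure n (Suc d) (insert x (set qs))"
    have "{y \<in> cube n. ?S qs y \<noteq> ?S (qs @ [x]) y} \<subseteq> (if card ?C \<le> t then ?C else {})"
      by (auto simp: erasure_strategy_def closure_erasures_snoc)
    then have "oracle_dist (cube n) (?S qs) (?S (qs @ [x])) \<le> card (if card ?C \<le> t then ?C else {})"
      unfolding oracle_dist_def by (intro card_mono) (simp_all add: finite_poly_closure)
    then show ?thesis by (simp split: if_splits)
  qed
  have rate: "\<lfloor>real (i + 1) * real t\<rfloor> - \<lfloor>real i * real t\<rfloor> = int t" for i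
  proof -
    have "\<lfloor>real j * real t\<rfloor> = int (j * t)" for j by (metis floor_of_nat of_nat_mult)
    then show ?thesis by (simp only:) simp
  qed
  have "starts_with (cube n) f ?S"
    by (simp add: starts_with_def erasure_strategy_def closure_erasures_Nil)
  moreover have "fixed_rate (cube n) (real t) ?S"
    unfolding fixed_rate_def Let_def rate using dist by simp
  moreover have "erasing (cube n) ?S"
    by (auto simp: erasing_def erasure_strategy_def closure_erasures_snoc)
  ultimately show ?thesis unfolding fixed_rate_erasure_adversary_def by blast
qed

text \<open>After at most \<open>q\<close> queries the closure has fewer than
  \<open>2 ^ k \<le> t\<close> points, so it was not skipped; an unerased point lies outside
  it.\<close>

lemma unerased_independent:
  assumes q: "q < light_count e (2 ^ k)" and t: "2 ^ k \<le> t"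
    and qs: "length qs \<le> q" and x: "x \<in> cube n" "x \<notin> closure_erasures n e t qs"
  shows "\<exists>g\<in>polys0 n e. (\<forall>y\<in>set qs. g y = 0) \<and> g x = 1"
proof -
  have "light_count e (card (poly_closure n e (set qs))) \<le> card (set qs)"
    by (rule light_count_card_poly_closure_le) simp
  also have "\<dots> < light_count e (2 ^ k)" using card_length[of qs] qs q by linarith
  finally have "card (poly_closure n e (set qs)) < 2 ^ k" using light_count_mono not_le by blast
  then have "x \<notin> poly_closure n e (set qs)" using x t unfolding closure_erasures_def by force
  then obtain g where "g \<in> polys0 n e" "\<forall>y\<in>set qs. g y = 0" "g x \<noteq> 0"
    using x(1) unfolding poly_closure_def by blast
  then show ?thesis by (metis bit.exhaust)
qed

text \<open>With too few queries the average acceptance probability is the same over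
  \<open>V\<close> and over \<open>W\<close>. It is at least 2/3 over the polynomials, but below 2/3
  over all functions.\<close>

lemma tester_queries_ge_light_count:
  assumes tester: "online_tester (cube n) (polys n d) \<epsilon>
      (fixed_rate_erasure_adversary (cube n) (real t)) T"
    and queries: "makes_at_most (fixed_rate_erasure_adversary (cube n) (real t)) T q"
    and t: "2 ^ k \<le> t" and "\<epsilon> \<le> 1 / 3"
    and n: "3 * (2 ^ card (low_sets n (Suc d)) * ((3 / 2) ^ card (cube n) * 2 powr (card (cube n) / 3)))
      < (2 :: real) ^ card (cube n)"
  shows "light_count (Suc d) (2 ^ k) \<le> q"
proof (rule ccontr)
  assume "\<not> light_count (Suc d) (2 ^ k) \<le> q"
  then have q: "q < light_count (Suc d) (2 ^ k)" by simp
  define E where "E = closure_erasures n (Suc d) t"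
  define V where "V = polys0 n (Suc d)"
  define W :: "(bit list \<Rightarrow> bit) set" where "W = supported (cube n)"
  define p where "p = (\<lambda>f. measure_pmf.prob T {a. accepts (erasure_strategy E f) a})"
  have S: "erasure_strategy E f \<in> fixed_rate_erasure_adversary (cube n) (real t) f" for f
    unfolding E_def by (rule erasure_strategy_adversary)
  have fin: "finite V" "finite W"
    unfolding V_def W_def by (simp_all add: finite_polys0 finite_supported finite_cube)
  have "card {f \<in> V. accepts (erasure_strategy E f) a} * card W
      = card {f \<in> W. accepts (erasure_strategy E f) a} * card V" if a: "a \<in> set_pmf T" for a
    unfolding accepts_def
  proof (rule card_accepting_eq[where D = "cube n" and K = V and q = q, OF _ fin])
    show "\<exists>g\<in>V. (\<forall>y\<in>set qs. g y = 0) \<and> g x = 1"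
      if "length qs \<le> q" "x \<in> cube n" "x \<notin> E qs" for qs x
      using unerased_independent[OF q t] that unfolding V_def E_def by blast
    show "translation_closed V (set []) V"
      unfolding translation_closed_def V_def using polys0_add by blast
    show "translation_closed V (set []) W"
      using polys0_supported[of n "Suc d"]
      unfolding translation_closed_def V_def W_def supported_def by fastforce
    show "queries_in (cube n) a" using tester a unfolding online_tester_def by blast
    show "length (fst (run (erasure_strategy E f) a [])) \<le> q" for f
      using queries S a unfolding makes_at_most_def num_queries_def by blast
  qed simp
  then have "measure_pmf.expectation T (\<lambda>a. real (card {f \<in> V. accepts (erasure_strategy E f) a}) * real (card W))
    = measure_pmf.expectation T (\<lambda>a. real (card {f \<in> W. accepts (erasure_strategy E f) a}) * real (card V))"
    by (intro integral_cong_AE) (simp_all add: AE_measure_pmf_iff flip: of_nat_mult)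
  then have eq: "(\<Sum>f\<in>V. p f) * real (card W) = (\<Sum>f\<in>W. p f) * real (card V)"
    unfolding p_def sum_prob_eq_expectation_card[OF fin(1)] sum_prob_eq_expectation_card[OF fin(2)]
    by simp
  have "V \<noteq> {}" using zero_in_polys0 V_def by blast
  then have posV: "0 < real (card V)" using fin by (simp add: card_gt_0_iff)
  have cardW: "real (card W) = 2 ^ card (cube n)"
    unfolding W_def by (simp add: card_supported finite_cube)
  have "2 / 3 \<le> p f" if "f \<in> V" for f
    using tester S[of f] polys0_subset_polys[of n d] that
    unfolding online_tester_def p_def V_def by blast
  then have "(\<Sum>f\<in>V. 2 / 3) \<le> (\<Sum>f\<in>V. p f)" by (rule sum_mono)
  then have "2 / 3 * real (card V) * real (card W) \<le> (\<Sum>f\<in>V. p f) * real (card W)"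
    by (intro mult_right_mono) simp_all
  moreover have "(\<Sum>f\<in>W. p f) < 2 / 3 * real (card W)"
  proof -
    let ?near = "{f \<in> W. \<not> far_from (cube n) \<epsilon> (polys n d) f}"
    \<comment> \<open>Far inputs contribute at most 1/3 each; the others, fewer than a third of
      \<open>W\<close>, are charged with 1 more.\<close>
    have "p f \<le> 1 / 3 + (if \<not> far_from (cube n) \<epsilon> (polys n d) f then 1 else 0)" for f
    proof (cases "far_from (cube n) \<epsilon> (polys n d) f")
      case True
      then have "2 / 3 \<le> measure_pmf.prob T {a. \<not> accepts (erasure_strategy E f) a}"
        using tester S[of f] unfolding online_tester_def by blast
      then show ?thesis
        using True measure_pmf.prob_neg[of T "accepts (erasure_strategy E f)"] unfolding p_def by simp
    next
      case False
      have "p f \<le> 1" unfolding p_def by simp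
      then show ?thesis using False by simp
    qed
    then have "(\<Sum>f\<in>W. p f) \<le> (\<Sum>f\<in>W. 1 / 3 + (if \<not> far_from (cube n) \<epsilon> (polys n d) f then 1 else 0))"
      by (rule sum_mono)
    also have "\<dots> = real (card W) / 3 + real (card ?near)"
      using fin by (simp add: sum.distrib sum.If_cases Int_def)
    finally have "(\<Sum>f\<in>W. p f) \<le> real (card W) / 3 + real (card ?near)" .
    moreover have "3 * real (card ?near) < real (card W)"
      using card_not_far_from_polys_le[OF \<open>\<epsilon> \<le> 1 / 3\<close>, of n d] n unfolding cardW unfolding W_def by linarith
    ultimately show ?thesis by linarith
  qed
  then have "(\<Sum>f\<in>W. p f) * real (card V) < 2 / 3 * real (card W) * real (card V)"
    using posV by (rule mult_strict_right_mono)
  ultimately show False using eq by (simp add: mult_ac)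
qed

theorem theorem1p2:
  fixes d :: nat
  assumes "d > 1"
  shows "\<exists>n0::nat. \<exists>c::real. c > 0 \<and>
    (\<forall>n\<ge>n0. \<forall>\<epsilon>::real. \<forall>t::nat. 0 < \<epsilon> \<and> \<epsilon> \<le> 1 / 3 \<and> t \<ge> 1 \<longrightarrow>
      (\<forall>(T :: (bit list, bit) algorithm pmf) q::nat.
        online_tester (cube n) (polys n d) \<epsilon>
          (fixed_rate_erasure_adversary (cube n) (real t)) T \<longrightarrow>
        makes_at_most (fixed_rate_erasure_adversary (cube n) (real t)) T q \<longrightarrow>
        real q \<ge> c * (log 2 (real t)) ^ d))"
proof -
  obtain n0 where n0: "\<And>n. n \<ge> n0 \<Longrightarrow>
      3 * (2 ^ card (low_sets n (Suc d)) * ((3 / 2) ^ card (cube n) * 2 powr (card (cube n) / 3)))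
      < (2 :: real) ^ card (cube n)"
    using eventually_few_functions_near_polys[of d] unfolding eventually_at_top_linorder by blast
  have "real q \<ge> (1 / (2 * real d)) ^ d * log 2 (real t) ^ d"
    if "n \<ge> n0" "\<epsilon> \<le> 1 / 3" "t \<ge> 1"
      and "online_tester (cube n) (polys n d) \<epsilon> (fixed_rate_erasure_adversary (cube n) (real t)) T"
      and "makes_at_most (fixed_rate_erasure_adversary (cube n) (real t)) T q"
    for n t q :: nat and \<epsilon> :: real and T :: "(bit list, bit) algorithm pmf"
  proof -
    obtain k where k: "2 ^ k \<le> t"
      "(1 / (2 * real d)) ^ d * log 2 (real t) ^ d \<le> real (light_count (Suc d) (2 ^ k))"
      using light_count_ge_log_power[of d t] assms \<open>t \<ge> 1\<close> by auto
    have "light_count (Suc d) (2 ^ k) \<le> q"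
      using tester_queries_ge_light_count[OF that(4,5) k(1) that(2) n0[OF that(1)]] .
    then show ?thesis using k(2) by linarith
  qed
  moreover have "(1 / (2 * real d)) ^ d > 0" using assms by simp
  ultimately show ?thesis by blast
qed

end
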